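(* Let $n,L,n_1,\ldots,n_L\in\{1,2,\ldots\}$ with $n=n_1+\cdots+n_L$, let $\lambda=(n_1,n_2,\ldots,n_L)$, and let $\mathcal{B}_\lambda\subseteq\mathcal{M}_n$ be the subalgebra of all block-diagonal matrices $\mathrm{diag}(A_1,\ldots,A_L)$ with $A_i\in\mathcal{M}_{n_i}$ for $1\le i\le L$. If $X\in\mathcal{M}_n$ is positive, then \[ \frac1L\|X\|_{\mathrm{op}}\le\|P_{\mathcal{B}_\lambda}(X)\|_{\mathrm{op}}. \] Moreover, \[ \frac{1}{\sqrt{L}}\|X\|_{\mathrm{op}}\le\|X\|_{\mathcal{B}_\lambda} \] for all $X\in\mathcal{M}_n$.
   Context: $\mathcal{M}_n$ is the C*-algebra of complex $n\times n$ matrices with operator norm $\|\cdot\|_{\mathrm{op}}$ induced by the 2-norm on $\mathbb{C}^n$; positive means positive semidefinite. For a unital C*-subalgebra $\mathcal{B}\subseteq\mathcal{M}_n$ (containing $I_n$), $P_{\mathcal{B}}:\mathcal{M}_n\to\mathcal{B}$ is the unique conditional expectation onto $\mathcal{B}$ (linear map with $P(B)=B$ for $B\in\mathcal{B}$ and $\|P(A)\|_{\mathrm{op}}\le\|A\|_{\mathrm{op}}$) that preserves $\tau=\frac1n\mathrm{Tr}$, i.e. $\tau\circ P_{\mathcal{B}}=\tau$; equivalently, $P_{\mathcal{B}}$ is the orthogonal projection onto $\mathcal{B}$ for the inner product $\langle A,B\rangle=\tau(B^*A)$. The Frobenius--Rieffel norm is $\|A\|_{\mathcal{B}}=\sqrt{\|P_{\mathcal{B}}(A^*A)\|_{\mathrm{op}}}$.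 *)

theory Defs
  imports
    "Jordan_Normal_Form.Schur_Decomposition"
    "HOL-Analysis.L2_Norm"
    "HOL-Library.FuncSet"
begin

definition vec_norm2 :: "complex vec \<Rightarrow> real" where
  "vec_norm2 v = L2_set (\<lambda>i. cmod (v $ i)) {..<dim_vec v}"

definition op_norm :: "complex mat \<Rightarrow> real" where
  "op_norm A = Sup {vec_norm2 (A *\<^sub>v v) | v. v \<in> carrier_vec (dim_col A) \<and> vec_norm2 v \<le> 1}"

text \<open>In the order on complex numbers used here, \<open>0 \<le> z\<close> means that
  \<open>z\<close> is real and nonnegative. Hence the condition below includes self-adjointness of \<open>A\<close>.\<close>

definition positive_mat :: "nat \<Rightarrow> complex mat \<Rightarrow> bool" where
  "positive_mat n A \<longleftrightarrow> A \<in> carrier_mat n n \<and> (\<forall>v \<in> carrier_vec n. 0 \<le> (A *\<^sub>v v) \<bullet>c v)"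

definition tau :: "nat \<Rightarrow> complex mat \<Rightarrow> complex" where
  "tau n A = (\<Sum>i<n. A $$ (i, i)) / of_nat n"

definition conditional_expectation ::
  "nat \<Rightarrow> complex mat set \<Rightarrow> (complex mat \<Rightarrow> complex mat) \<Rightarrow> bool" where
  "conditional_expectation n B P \<longleftrightarrow>
     P \<in> carrier_mat n n \<rightarrow> B \<and>
     (\<forall>X \<in> carrier_mat n n. \<forall>Y \<in> carrier_mat n n. P (X + Y) = P X + P Y) \<and>
     (\<forall>c. \<forall>X \<in> carrier_mat n n. P (c \<cdot>\<^sub>m X) = c \<cdot>\<^sub>m P X) \<and>
     (\<forall>X \<in> B. P X = X) \<and>
     (\<forall>X \<in> carrier_mat n n. op_norm (P X) \<le> op_norm X)"

text \<open>The map \<open>P\<^sub>B\<close>, for a unital C*-subalgebra \<open>B\<close> of the \<open>n \<times> n\<close> matrices.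
  Extensionality fixes the irrelevant values outside the \<open>n \<times> n\<close> matrices, without which
  the HOL function would not be unique.\<close>

definition cond_exp :: "nat \<Rightarrow> complex mat set \<Rightarrow> complex mat \<Rightarrow> complex mat" where
  "cond_exp n B = (THE P. P \<in> extensional (carrier_mat n n) \<and>
     conditional_expectation n B P \<and>
     (\<forall>X \<in> carrier_mat n n. tau n (P X) = tau n X))"

definition frobenius_rieffel_norm :: "nat \<Rightarrow> complex mat set \<Rightarrow> complex mat \<Rightarrow> real" where
  "frobenius_rieffel_norm n B A = sqrt (op_norm (cond_exp n B (mat_adjoint A * A)))"

definition block_diag_algebra :: "nat list \<Rightarrow> complex mat set" where
  "block_diag_algebra ns =
     {diag_block_mat As | As. list_all2 (\<lambda>A k. A \<in> carrier_mat k k) As ns}"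

end

theory Submission
  imports Defs
begin

text \<open>The conditional expectation onto the block-diagonal matrices is the pinching \<open>E\<close> that deletes
  all entries outside the diagonal blocks. Convexity of \<open>v \<mapsto> \<langle>X v, v\<rangle>\<close> for positive \<open>X\<close>, applied to the
  decomposition of \<open>v\<close> into its \<open>L\<close> block components, gives \<open>X \<le> L E(X)\<close>, and hence the first
  inequality. The second one is the first one for \<open>X\<^sup>* X\<close>, whose norm is at least \<open>\<parallel>X\<parallel>\<^sup>2\<close>.\<close>

section \<open>The operator norm\<close>

lemma vec_norm2_nonneg: "0 \<le> vec_norm2 v"
  by (simp add: vec_norm2_def)

lemma vec_norm2_power2: "(vec_norm2 v)\<^sup>2 = (\<Sum>i<dim_vec v. (cmod (v $ i))\<^sup>2)"
  by (simp add: vec_norm2_def L2_set_def sum_nonneg)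

lemma vec_norm2_smult: "vec_norm2 (c \<cdot>\<^sub>v v) = cmod c * vec_norm2 v"
  by (simp add: vec_norm2_def L2_set_right_distrib norm_mult cong: L2_set_cong_simp)

lemma vec_norm2_eq_0_iff: "vec_norm2 v = 0 \<longleftrightarrow> v = 0\<^sub>v (dim_vec v)"
  by (auto simp: vec_norm2_def L2_set_eq_0_iff intro!: eq_vecI)
     (metis index_zero_vec(1))

lemma mult_mat_vec_index:
  assumes "A \<in> carrier_mat nr nc" "v \<in> carrier_vec nc" "i < nr"
  shows "(A *\<^sub>v v) $ i = (\<Sum>j<nc. A $$ (i, j) * v $ j)"
  using assms by (auto simp: scalar_prod_def atLeast0LessThan intro!: sum.cong)

lemma cmod_sum_mult_le_L2_set:
  "cmod (\<Sum>i\<in>S. f i * g i) \<le> L2_set (\<lambda>i. cmod (f i)) S * L2_set (\<lambda>i. cmod (g i)) S"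
proof -
  have "cmod (\<Sum>i\<in>S. f i * g i) \<le> (\<Sum>i\<in>S. \<bar>cmod (f i)\<bar> * \<bar>cmod (g i)\<bar>)"
    by (rule order_trans[OF norm_sum]) (simp add: norm_mult)
  also have "\<dots> \<le> L2_set (\<lambda>i. cmod (f i)) S * L2_set (\<lambda>i. cmod (g i)) S"
    by (rule L2_set_mult_ineq)
  finally show ?thesis .
qed

text \<open>Cauchy-Schwarz in each row. The crude bound serves twice: it makes the supremum in
  \<open>op_norm\<close> finite, and it controls the growth of norms in the uniqueness argument for
  the conditional expectation.\<close>

lemma vec_norm2_mult_le_frobenius:
  assumes A: "A \<in> carrier_mat nr nc" and v: "v \<in> carrier_vec nc"
  shows "vec_norm2 (A *\<^sub>v v) \<le> sqrt (\<Sum>i<nr. \<Sum>j<nc. (cmod (A $$ (i, j)))\<^sup>2) * vec_norm2 v"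
proof (rule power2_le_imp_le)
  have "(vec_norm2 (A *\<^sub>v v))\<^sup>2 = (\<Sum>i<nr. (cmod (\<Sum>j<nc. A $$ (i, j) * v $ j))\<^sup>2)"
    using A mult_mat_vec_index[OF A v] by (simp add: vec_norm2_power2 cong: sum.cong_simp)
  also have "\<dots> \<le> (\<Sum>i<nr. (L2_set (\<lambda>j. cmod (A $$ (i, j))) {..<nc} * vec_norm2 v)\<^sup>2)"
    using v by (intro sum_mono power_mono)
      (auto simp: vec_norm2_def intro!: cmod_sum_mult_le_L2_set)
  also have "\<dots> = (\<Sum>i<nr. \<Sum>j<nc. (cmod (A $$ (i, j)))\<^sup>2) * (vec_norm2 v)\<^sup>2"
    by (simp add: power_mult_distrib L2_set_def sum_nonneg flip: sum_distrib_right)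
  also have "\<dots> = (sqrt (\<Sum>i<nr. \<Sum>j<nc. (cmod (A $$ (i, j)))\<^sup>2) * vec_norm2 v)\<^sup>2"
    by (simp add: power_mult_distrib sum_nonneg)
  finally show "(vec_norm2 (A *\<^sub>v v))\<^sup>2
      \<le> (sqrt (\<Sum>i<nr. \<Sum>j<nc. (cmod (A $$ (i, j)))\<^sup>2) * vec_norm2 v)\<^sup>2" .
qed (simp add: vec_norm2_nonneg sum_nonneg)

lemma op_norm_le:
  assumes A: "A \<in> carrier_mat nr nc" and "0 \<le> c"
    and le: "\<And>v. v \<in> carrier_vec nc \<Longrightarrow> vec_norm2 (A *\<^sub>v v) \<le> c * vec_norm2 v"
  shows "op_norm A \<le> c"
  unfolding op_norm_def
proof (rule cSup_least)
  have "vec_norm2 (0\<^sub>v nc) \<le> 1"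
    using vec_norm2_eq_0_iff[of "0\<^sub>v nc"] by simp
  then show "{vec_norm2 (A *\<^sub>v v) | v. v \<in> carrier_vec (dim_col A) \<and> vec_norm2 v \<le> 1} \<noteq> {}"
    using A by (auto intro!: exI[of _ "0\<^sub>v nc"])
next
  fix x assume "x \<in> {vec_norm2 (A *\<^sub>v v) | v. v \<in> carrier_vec (dim_col A) \<and> vec_norm2 v \<le> 1}"
  then obtain v where v: "x = vec_norm2 (A *\<^sub>v v)" "v \<in> carrier_vec nc" "vec_norm2 v \<le> 1"
    using A by auto
  have "x \<le> c * vec_norm2 v"
    using le v by simp
  also have "\<dots> \<le> c"
    using v(3) \<open>0 \<le> c\<close> mult_left_le by blast
  finally show "x \<le> c" .
qed

text \<open>A real \<open>Sup\<close> is only an upper bound for a set that is bounded above, so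
  every lower estimate of \<open>op_norm\<close> rests on this.\<close>

lemma bdd_above_op_norm:
  "bdd_above {vec_norm2 (A *\<^sub>v v) | v. v \<in> carrier_vec (dim_col A) \<and> vec_norm2 v \<le> 1}"
proof (rule bdd_aboveI, clarify)
  fix v :: "complex vec" assume v: "v \<in> carrier_vec (dim_col A)" "vec_norm2 v \<le> 1"
  show "vec_norm2 (A *\<^sub>v v)
      \<le> sqrt (\<Sum>i<dim_row A. \<Sum>j<dim_col A. (cmod (A $$ (i, j)))\<^sup>2)"
    using vec_norm2_mult_le_frobenius[OF _ v(1), of A "dim_row A"] v(2)
    by (smt (verit, ccfv_threshold) carrier_matI mult_left_le real_sqrt_ge_zero sum_nonneg zero_le_power2)
qed

lemma op_norm_nonneg: "0 \<le> op_norm A"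
proof -
  have "vec_norm2 (A *\<^sub>v 0\<^sub>v (dim_col A)) \<le> op_norm A"
    unfolding op_norm_def
    using vec_norm2_eq_0_iff[of "0\<^sub>v (dim_col A)"]
    by (intro cSup_upper[OF _ bdd_above_op_norm]) auto
  then show ?thesis
    using vec_norm2_nonneg order_trans by blast
qed

text \<open>By homogeneity: a vector of nonzero norm is scaled to norm one, where the supremum
  applies directly.\<close>

lemma vec_norm2_mult_le:
  assumes A: "A \<in> carrier_mat nr nc" and v: "v \<in> carrier_vec nc"
  shows "vec_norm2 (A *\<^sub>v v) \<le> op_norm A * vec_norm2 v"
proof (cases "vec_norm2 v = 0")
  case True
  then show ?thesis
    using vec_norm2_mult_le_frobenius[OF A v] by simp
next
  case False
  then have pos: "0 < vec_norm2 v"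
    using vec_norm2_nonneg[of v] by simp
  define u where "u = complex_of_real (1 / vec_norm2 v) \<cdot>\<^sub>v v"
  have "vec_norm2 u = 1"
    using pos by (simp add: u_def vec_norm2_smult norm_divide)
  then have "vec_norm2 (A *\<^sub>v u) \<le> op_norm A"
    unfolding op_norm_def using A v
    by (intro cSup_upper[OF _ bdd_above_op_norm]) (auto simp: u_def)
  moreover have "vec_norm2 (A *\<^sub>v u) = vec_norm2 (A *\<^sub>v v) / vec_norm2 v"
    using pos A v by (simp add: u_def mult_mat_vec vec_norm2_smult norm_divide)
  ultimately show ?thesis
    using pos by (simp add: divide_le_eq)
qed

lemma op_norm_le_frobenius:
  assumes "A \<in> carrier_mat nr nc"
  shows "op_norm A \<le> sqrt (\<Sum>i<nr. \<Sum>j<nc. (cmod (A $$ (i, j)))\<^sup>2)"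
  using assms by (intro op_norm_le vec_norm2_mult_le_frobenius) (auto intro!: sum_nonneg)

text \<open>Apply \<open>A\<close> to the unit vector \<open>unit_vec nc j\<close> and read off
  coordinate \<open>i\<close>.\<close>

lemma cmod_index_le_op_norm:
  assumes A: "A \<in> carrier_mat nr nc" and i: "i < nr" and j: "j < nc"
  shows "cmod (A $$ (i, j)) \<le> op_norm A"
proof -
  have "L2_set (\<lambda>k. cmod (unit_vec nc j $ k)) {..<nc} = sqrt (\<Sum>k<nc. if k = j then 1 else 0)"
    unfolding L2_set_def by (intro arg_cong[of _ _ sqrt] sum.cong) (auto simp: j)
  then have norm: "vec_norm2 (unit_vec nc j) = 1"
    using j by (simp add: vec_norm2_def)
  have "A $$ (i, j) = (A *\<^sub>v unit_vec nc j) $ i"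
    using A i j by (simp add: mult_mat_vec_def)
  also have "cmod \<dots> \<le> vec_norm2 (A *\<^sub>v unit_vec nc j)"
    unfolding vec_norm2_def using A i by (intro member_le_L2_set) auto
  also have "\<dots> \<le> op_norm A"
    using vec_norm2_mult_le[OF A, of "unit_vec nc j"] norm by simp
  finally show ?thesis .
qed

section \<open>Sesquilinear forms of matrices\<close>

text \<open>The form \<open><X f, g>\<close>, linear in \<open>f\<close> and conjugate-linear in
  \<open>g\<close>. Its arguments are functions instead of vectors, so that sums and differences
  carry no dimension conditions.\<close>

definition sesq :: "nat \<Rightarrow> complex mat \<Rightarrow> (nat \<Rightarrow> complex) \<Rightarrow> (nat \<Rightarrow> complex) \<Rightarrow> complex" where
  "sesq n X f g = (\<Sum>i<n. \<Sum>j<n. X $$ (i, j) * f j * cnj (g i))"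

lemma sesq_add_left: "sesq n X (\<lambda>i. f i + f' i) g = sesq n X f g + sesq n X f' g"
  and sesq_add_right: "sesq n X f (\<lambda>i. g i + g' i) = sesq n X f g + sesq n X f g'"
  and sesq_diff_left: "sesq n X (\<lambda>i. f i - f' i) g = sesq n X f g - sesq n X f' g"
  and sesq_diff_right: "sesq n X f (\<lambda>i. g i - g' i) = sesq n X f g - sesq n X f g'"
  by (simp_all add: sesq_def algebra_simps sum.distrib sum_subtractf)

lemma sesq_mult_left: "sesq n X (\<lambda>i. c * f i) g = c * sesq n X f g"
  and sesq_mult_right: "sesq n X f (\<lambda>i. c * g i) = cnj c * sesq n X f g"
  by (simp_all add: sesq_def algebra_simps sum_distrib_left)

lemma sesq_sum_left: "sesq n X (\<lambda>i. \<Sum>b\<in>S. F b i) g = (\<Sum>b\<in>S. sesq n X (F b) g)"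
  by (induction S rule: infinite_finite_induct) (simp_all add: sesq_add_left, simp_all add: sesq_def)

lemma sesq_sum_right: "sesq n X f (\<lambda>i. \<Sum>b\<in>S. G b i) = (\<Sum>b\<in>S. sesq n X f (G b))"
  by (induction S rule: infinite_finite_induct) (simp_all add: sesq_add_right, simp_all add: sesq_def)

lemma sesq_cong:
  "(\<And>i. i < n \<Longrightarrow> f i = f' i) \<Longrightarrow> (\<And>i. i < n \<Longrightarrow> g i = g' i) \<Longrightarrow> sesq n X f g = sesq n X f' g'"
  by (simp add: sesq_def)

lemma cscalar_prod_eq_sum:
  assumes "v \<in> carrier_vec n" "w \<in> carrier_vec n"
  shows "v \<bullet>c w = (\<Sum>i<n. v $ i * cnj (w $ i))"
  using assms by (auto simp: scalar_prod_def atLeast0LessThan intro!: sum.cong)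

lemma cscalar_prod_self: "v \<bullet>c v = complex_of_real ((vec_norm2 v)\<^sup>2)"
  by (simp only: cscalar_prod_eq_sum[OF carrier_vec_dim_vec carrier_vec_dim_vec] vec_norm2_power2
      of_real_sum complex_norm_square)

lemma cmod_cscalar_prod_le:
  assumes "v \<in> carrier_vec n" "w \<in> carrier_vec n"
  shows "cmod (v \<bullet>c w) \<le> vec_norm2 v * vec_norm2 w"
  using assms cmod_sum_mult_le_L2_set[of "\<lambda>i. v $ i" "\<lambda>i. cnj (w $ i)" "{..<n}"]
  by (simp add: cscalar_prod_eq_sum vec_norm2_def)

lemma sesq_eq_cscalar_prod:
  assumes "X \<in> carrier_mat n n" "v \<in> carrier_vec n" "w \<in> carrier_vec n"
  shows "sesq n X (($) v) (($) w) = (X *\<^sub>v v) \<bullet>c w"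
  using assms
  by (simp add: cscalar_prod_eq_sum[of _ n] mult_mat_vec_index[of X n n] sesq_def sum_distrib_right
      del: index_mult_mat_vec)

lemma positive_mat_sesq:
  assumes "positive_mat n X"
  shows "0 \<le> sesq n X f f"
proof -
  have "sesq n X f f = sesq n X (($) (vec n f)) (($) (vec n f))"
    by (rule sesq_cong) auto
  then show ?thesis
    using assms sesq_eq_cscalar_prod[of X n "vec n f" "vec n f"] by (simp add: positive_mat_def)
qed

text \<open>Polarization: the form is real at \<open>f\<close>, \<open>g\<close> and
  \<open>f + \<i> g\<close>, and the imaginary part at the last point is
  \<open>Re <X g, f> - Re <X f, g>\<close>.\<close>

lemma positive_mat_sesq_Re_commute:
  assumes "positive_mat n X"
  shows "Re (sesq n X f g) = Re (sesq n X g f)"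
proof -
  have im: "Im (sesq n X h h) = 0" for h
    using positive_mat_sesq[OF assms, of h] by (simp add: less_eq_complex_def)
  have "Im (sesq n X (\<lambda>i. f i + \<i> * g i) (\<lambda>i. f i + \<i> * g i)) = 0"
    by (rule im)
  then show ?thesis
    by (simp add: sesq_add_left sesq_add_right sesq_mult_left sesq_mult_right im)
qed

text \<open>Expanding \<open>0 \<le> \<langle>X u, u\<rangle>\<close> at \<open>u = v - X v / c\<close> bounds \<open>\<parallel>X v\<parallel>\<close> without any
  spectral theory.\<close>

lemma positive_mat_op_norm_le:
  assumes pos: "positive_mat n X" and "0 < c"
    and le: "\<And>v. v \<in> carrier_vec n \<Longrightarrow> Re ((X *\<^sub>v v) \<bullet>c v) \<le> c * (vec_norm2 v)\<^sup>2"
  shows "op_norm X \<le> c"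
proof (rule op_norm_le)
  show X: "X \<in> carrier_mat n n"
    using pos by (simp add: positive_mat_def)
  fix v :: "complex vec" assume v: "v \<in> carrier_vec n"
  define w where "w = X *\<^sub>v v"
  have w: "w \<in> carrier_vec n"
    using X v by (simp add: w_def)
  \<comment> \<open>The value \<open>1 / c\<close> minimises
    \<open>c * s^2 * |w|^2 - 2 * s * |w|^2\<close>, the bound for the terms that involve
    \<open>w\<close>.\<close>
  define s where "s = complex_of_real (1 / c)"
  have vw: "Re (sesq n X (($) v) (($) w)) = (vec_norm2 w)\<^sup>2"
    using sesq_eq_cscalar_prod[OF X v w] cscalar_prod_self[of w]
    by (simp flip: w_def del: of_real_power)
  have qv: "Re (sesq n X (($) v) (($) v)) \<le> c * (vec_norm2 v)\<^sup>2"
    using le[OF v] sesq_eq_cscalar_prod[OF X v v] by simp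
  have qw: "Re (sesq n X (($) w) (($) w)) \<le> c * (vec_norm2 w)\<^sup>2"
    using le[OF w] sesq_eq_cscalar_prod[OF X w w] by simp
  have expand: "sesq n X (\<lambda>i. v $ i - s * w $ i) (\<lambda>i. v $ i - s * w $ i)
      = sesq n X (($) v) (($) v) - s * sesq n X (($) w) (($) v)
        - cnj s * sesq n X (($) v) (($) w) + s * cnj s * sesq n X (($) w) (($) w)"
    by (simp add: sesq_diff_left sesq_diff_right sesq_mult_left sesq_mult_right)
  have "0 \<le> Re (sesq n X (\<lambda>i. v $ i - s * w $ i) (\<lambda>i. v $ i - s * w $ i))"
    using positive_mat_sesq[OF pos] by (simp add: less_eq_complex_def)
  \<comment> \<open>Both cross terms have real part \<open>|w|^2 / c\<close>, one by
    \<open>vw\<close> and the other by the symmetry of the real part.\<close>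
  also have "\<dots> = Re (sesq n X (($) v) (($) v)) - 2 * (vec_norm2 w)\<^sup>2 / c
      + Re (sesq n X (($) w) (($) w)) / c\<^sup>2"
    using vw positive_mat_sesq_Re_commute[OF pos, of "($) w" "($) v"]
    unfolding expand by (simp add: s_def power2_eq_square)
  also have "\<dots> \<le> c * (vec_norm2 v)\<^sup>2 - 2 * (vec_norm2 w)\<^sup>2 / c + c * (vec_norm2 w)\<^sup>2 / c\<^sup>2"
    using qv qw \<open>0 < c\<close> by (intro add_mono diff_mono divide_right_mono) auto
  also have "\<dots> = c * (vec_norm2 v)\<^sup>2 - (vec_norm2 w)\<^sup>2 / c"
    using \<open>0 < c\<close> by (simp add: power2_eq_square)
  finally have "(vec_norm2 w)\<^sup>2 \<le> (c * vec_norm2 v)\<^sup>2"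
    using \<open>0 < c\<close> by (simp add: field_simps power2_eq_square)
  then show "vec_norm2 (X *\<^sub>v v) \<le> c * vec_norm2 v"
    unfolding w_def by (rule power2_le_imp_le) (use \<open>0 < c\<close> vec_norm2_nonneg[of v] in simp)
qed (use \<open>0 < c\<close> in simp)

section \<open>Products of a matrix with its adjoint\<close>

lemma mat_adjoint_mult_carrier:
  "X \<in> carrier_mat nr nc \<Longrightarrow> mat_adjoint X * X \<in> carrier_mat nc nc"
  by (auto simp: mat_adjoint_def)

text \<open>Swapping the double sum moves the adjoint to the other side of the inner product, which
  leaves \<open><X v, X v>\<close>.\<close>

lemma cscalar_prod_adjoint_mult:
  assumes X: "X \<in> carrier_mat n n" and v: "v \<in> carrier_vec n"
  shows "((mat_adjoint X * X) *\<^sub>v v) \<bullet>c v = complex_of_real ((vec_norm2 (X *\<^sub>v v))\<^sup>2)"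
proof -
  have Y: "mat_adjoint X \<in> carrier_mat n n"
    using X by (auto simp: mat_adjoint_def)
  have entry: "mat_adjoint X $$ (i, j) = cnj (X $$ (j, i))" if "i < n" "j < n" for i j
    using X that by (simp add: mat_adjoint_def mat_of_rows_def)
  define w where "w = X *\<^sub>v v"
  have w: "w \<in> carrier_vec n"
    using X v by (simp add: w_def)
  have w_index: "w $ j = (\<Sum>i<n. X $$ (j, i) * v $ i)" if "j < n" for j
    unfolding w_def using that by (rule mult_mat_vec_index[OF X v])
  have "((mat_adjoint X * X) *\<^sub>v v) \<bullet>c v = (mat_adjoint X *\<^sub>v w) \<bullet>c v"
    using Y X v by (simp add: w_def)
  also have "\<dots> = (\<Sum>i<n. \<Sum>j<n. cnj (X $$ (j, i)) * w $ j * cnj (v $ i))"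
    using sesq_eq_cscalar_prod[OF Y w v] by (simp add: sesq_def entry)
  also have "\<dots> = (\<Sum>j<n. w $ j * cnj (\<Sum>i<n. X $$ (j, i) * v $ i))"
    by (subst sum.swap) (simp add: sum_distrib_left mult_ac)
  also have "\<dots> = w \<bullet>c w"
    by (simp add: cscalar_prod_eq_sum[OF w w] w_index)
  finally show ?thesis
    by (simp add: cscalar_prod_self w_def)
qed

lemma positive_mat_adjoint_mult:
  assumes "X \<in> carrier_mat n n"
  shows "positive_mat n (mat_adjoint X * X)"
  using assms mat_adjoint_mult_carrier[OF assms] cscalar_prod_adjoint_mult[OF assms]
  by (simp add: positive_mat_def less_eq_complex_def)

text \<open>One half of the C*-identity: \<open>|X v|^2\<close> is the quadratic form of
  \<open>mat_adjoint X * X\<close> at \<open>v\<close>, which Cauchy-Schwarz bounds.\<close>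

lemma op_norm_power2_le:
  assumes X: "X \<in> carrier_mat n n"
  shows "(op_norm X)\<^sup>2 \<le> op_norm (mat_adjoint X * X)"
proof -
  let ?S = "mat_adjoint X * X"
  have S: "?S \<in> carrier_mat n n"
    using X by (rule mat_adjoint_mult_carrier)
  have "op_norm X \<le> sqrt (op_norm ?S)"
  proof (rule op_norm_le[OF X])
    fix v :: "complex vec" assume v: "v \<in> carrier_vec n"
    have Sv: "?S *\<^sub>v v \<in> carrier_vec n"
      using S v by (rule mult_mat_vec_carrier)
    have "(vec_norm2 (X *\<^sub>v v))\<^sup>2 = Re ((?S *\<^sub>v v) \<bullet>c v)"
      unfolding cscalar_prod_adjoint_mult[OF X v] by simp
    also have "\<dots> \<le> vec_norm2 (?S *\<^sub>v v) * vec_norm2 v"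
      by (rule order_trans[OF complex_Re_le_cmod cmod_cscalar_prod_le[OF Sv v]])
    also have "\<dots> \<le> op_norm ?S * vec_norm2 v * vec_norm2 v"
      by (intro mult_right_mono vec_norm2_mult_le[OF S v] vec_norm2_nonneg)
    also have "\<dots> = (sqrt (op_norm ?S) * vec_norm2 v)\<^sup>2"
      by (simp add: power_mult_distrib op_norm_nonneg) (simp add: power2_eq_square)
    finally show "vec_norm2 (X *\<^sub>v v) \<le> sqrt (op_norm ?S) * vec_norm2 v"
      by (rule power2_le_imp_le) (simp add: op_norm_nonneg vec_norm2_nonneg)
  qed (simp add: op_norm_nonneg)
  then show ?thesis
    using op_norm_nonneg by (metis power_mono real_sqrt_pow2)
qed

section \<open>Pinching\<close>

text \<open>The function \<open>\<beta>\<close> labels each index with its block. Blocks are thus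
  arbitrary classes of indices, and everything can be argued entrywise without block matrix
  arithmetic.\<close>

definition pinch :: "nat \<Rightarrow> (nat \<Rightarrow> nat) \<Rightarrow> complex mat \<Rightarrow> complex mat" where
  "pinch n \<beta> X = mat n n (\<lambda>(i, j). if \<beta> i = \<beta> j then X $$ (i, j) else 0)"

definition pinched_mats :: "nat \<Rightarrow> (nat \<Rightarrow> nat) \<Rightarrow> complex mat set" where
  "pinched_mats n \<beta> = {A \<in> carrier_mat n n. \<forall>i<n. \<forall>j<n. \<beta> i \<noteq> \<beta> j \<longrightarrow> A $$ (i, j) = 0}"

text \<open>The orthogonal projection of \<open>f\<close> onto the coordinates of block
  \<open>b\<close>.\<close>

definition part :: "(nat \<Rightarrow> nat) \<Rightarrow> nat \<Rightarrow> (nat \<Rightarrow> complex) \<Rightarrow> nat \<Rightarrow> complex" where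
  "part \<beta> b f i = (if \<beta> i = b then f i else 0)"

lemma pinch_carrier: "pinch n \<beta> X \<in> carrier_mat n n"
  by (simp add: pinch_def)

lemma pinch_mem: "pinch n \<beta> X \<in> pinched_mats n \<beta>"
  by (auto simp: pinch_def pinched_mats_def)

lemma pinch_eq_self: "X \<in> pinched_mats n \<beta> \<Longrightarrow> pinch n \<beta> X = X"
  by (auto simp: pinch_def pinched_mats_def intro!: eq_matI)

lemma sum_part:
  assumes "\<beta> i < L"
  shows "(\<Sum>b<L. part \<beta> b f i) = f i"
  using assms by (simp add: part_def)

text \<open>Pythagoras: the parts are supported on disjoint sets of indices.\<close>

lemma sum_vec_norm2_part:
  assumes \<beta>: "\<And>i. i < n \<Longrightarrow> \<beta> i < L"
  shows "(\<Sum>b<L. (vec_norm2 (vec n (part \<beta> b f)))\<^sup>2) = (\<Sum>i<n. (cmod (f i))\<^sup>2)"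
proof -
  have "(\<Sum>b<L. (vec_norm2 (vec n (part \<beta> b f)))\<^sup>2)
      = (\<Sum>i<n. \<Sum>b<L. if \<beta> i = b then (cmod (f i))\<^sup>2 else 0)"
    by (subst sum.swap) (auto simp: vec_norm2_power2 part_def intro!: sum.cong)
  also have "\<dots> = (\<Sum>i<n. (cmod (f i))\<^sup>2)"
    using \<beta> by simp
  finally show ?thesis .
qed

text \<open>Row \<open>i\<close> of the pinching sees only the part of \<open>v\<close> in the block
  of \<open>i\<close>. Each part is stretched by at most \<open>op_norm X\<close>, and the squared
  norms of the parts add up to that of \<open>v\<close>.\<close>

lemma op_norm_pinch_le:
  assumes X: "X \<in> carrier_mat n n" and \<beta>: "\<And>i. i < n \<Longrightarrow> \<beta> i < L"
  shows "op_norm (pinch n \<beta> X) \<le> op_norm X"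
proof (rule op_norm_le[OF pinch_carrier op_norm_nonneg])
  fix v :: "complex vec" assume v: "v \<in> carrier_vec n"
  define vb where "vb b = vec n (part \<beta> b (($) v))" for b
  have vb: "vb b \<in> carrier_vec n" for b
    by (simp add: vb_def)
  have index: "(pinch n \<beta> X *\<^sub>v v) $ i = (X *\<^sub>v vb (\<beta> i)) $ i" if i: "i < n" for i
  proof -
    have "(pinch n \<beta> X *\<^sub>v v) $ i = (\<Sum>j<n. pinch n \<beta> X $$ (i, j) * v $ j)"
      using i by (rule mult_mat_vec_index[OF pinch_carrier v])
    also have "\<dots> = (\<Sum>j<n. X $$ (i, j) * vb (\<beta> i) $ j)"
      using i by (intro sum.cong) (auto simp: pinch_def vb_def part_def)
    also have "\<dots> = (X *\<^sub>v vb (\<beta> i)) $ i"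
      using i by (rule mult_mat_vec_index[OF X vb, symmetric])
    finally show ?thesis .
  qed
  have "(vec_norm2 (pinch n \<beta> X *\<^sub>v v))\<^sup>2 = (\<Sum>i<n. (cmod ((X *\<^sub>v vb (\<beta> i)) $ i))\<^sup>2)"
    using pinch_carrier[of n \<beta> X] index
    by (auto simp: vec_norm2_power2 simp del: index_mult_mat_vec intro!: sum.cong)
  \<comment> \<open>The term for the block of \<open>i\<close> is one of the nonnegative terms of
    the sum over all blocks.\<close>
  also have "\<dots> \<le> (\<Sum>i<n. \<Sum>b<L. (cmod ((X *\<^sub>v vb b) $ i))\<^sup>2)"
    using \<beta> by (intro sum_mono member_le_sum) auto
  also have "\<dots> = (\<Sum>b<L. (vec_norm2 (X *\<^sub>v vb b))\<^sup>2)"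
    using X by (subst sum.swap) (auto simp: vec_norm2_power2)
  also have "\<dots> \<le> (\<Sum>b<L. (op_norm X * vec_norm2 (vb b))\<^sup>2)"
    using vec_norm2_mult_le[OF X vb] by (intro sum_mono power_mono vec_norm2_nonneg)
  also have "\<dots> = (op_norm X)\<^sup>2 * (\<Sum>b<L. (vec_norm2 (vb b))\<^sup>2)"
    by (simp add: power_mult_distrib sum_distrib_left)
  also have "\<dots> = (op_norm X * vec_norm2 v)\<^sup>2"
    using v sum_vec_norm2_part[OF \<beta>, where f = "($) v"]
    by (simp add: vb_def power_mult_distrib vec_norm2_power2)
  finally show "vec_norm2 (pinch n \<beta> X *\<^sub>v v) \<le> op_norm X * vec_norm2 v"
    by (rule power2_le_imp_le) (simp add: op_norm_nonneg vec_norm2_nonneg)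
qed

text \<open>With \<open>Q b\<close> the projection onto block \<open>b\<close>, the pinching is the
  sum of the compressions \<open>Q b * X * Q b\<close>.\<close>

lemma sesq_pinch:
  assumes \<beta>: "\<And>i. i < n \<Longrightarrow> \<beta> i < L"
  shows "sesq n (pinch n \<beta> X) f f = (\<Sum>b<L. sesq n X (part \<beta> b f) (part \<beta> b f))"
proof -
  have "(\<Sum>b<L. sesq n X (part \<beta> b f) (part \<beta> b f))
      = (\<Sum>i<n. \<Sum>j<n. \<Sum>b<L. X $$ (i, j) * part \<beta> b f j * cnj (part \<beta> b f i))"
    unfolding sesq_def by (subst sum.swap, rule sum.cong[OF refl], rule sum.swap)
  also have "\<dots> = (\<Sum>i<n. \<Sum>j<n. \<Sum>b<L.
      if \<beta> i = b then (if \<beta> i = \<beta> j then X $$ (i, j) * f j * cnj (f i) else 0) else 0)"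
    by (intro sum.cong) (auto simp: part_def)
  also have "\<dots> = sesq n (pinch n \<beta> X) f f"
    using \<beta> by (auto simp: sesq_def pinch_def intro!: sum.cong)
  finally show ?thesis ..
qed

text \<open>The parts \<open>v\<^sub>b\<close> of a vector satisfy \<open>\<Sum>\<^sub>a \<Sum>\<^sub>b \<langle>X (v\<^sub>a - v\<^sub>b), v\<^sub>a - v\<^sub>b\<rangle> \<ge> 0\<close>; this is
  \<open>X \<le> L E(X)\<close> as quadratic forms, where \<open>E\<close> is the pinching.\<close>

lemma sesq_le_pinch:
  assumes pos: "positive_mat n X" and \<beta>: "\<And>i. i < n \<Longrightarrow> \<beta> i < L"
  shows "Re (sesq n X f f) \<le> real L * Re (sesq n (pinch n \<beta> X) f f)"
proof -
  define s where "s a b = sesq n X (part \<beta> a f) (part \<beta> b f)" for a b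
  have total: "(\<Sum>a<L. \<Sum>b<L. s a b) = sesq n X f f"
  proof -
    have "sesq n X f f = sesq n X (\<lambda>i. \<Sum>a<L. part \<beta> a f i) (\<lambda>i. \<Sum>b<L. part \<beta> b f i)"
      by (rule sesq_cong) (simp_all add: sum_part \<beta>)
    then show ?thesis
      by (simp add: sesq_sum_left sesq_sum_right s_def)
  qed
  have diag: "(\<Sum>a<L. s a a) = sesq n (pinch n \<beta> X) f f"
    using sesq_pinch[OF \<beta>, where X = X and f = f] by (simp add: s_def)
  have "0 \<le> (\<Sum>a<L. \<Sum>b<L. Re (sesq n X (\<lambda>i. part \<beta> a f i - part \<beta> b f i)
      (\<lambda>i. part \<beta> a f i - part \<beta> b f i)))"
    using positive_mat_sesq[OF pos] by (intro sum_nonneg) (simp add: less_eq_complex_def)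
  also have "\<dots> = Re (\<Sum>a<L. \<Sum>b<L. s a a + s b b - s a b - s b a)"
    by (simp add: sesq_diff_left sesq_diff_right s_def algebra_simps)
  \<comment> \<open>Each diagonal term occurs \<open>L\<close> times through \<open>a\<close> and
    \<open>L\<close> times through \<open>b\<close>; the two mixed sums agree after exchanging
    \<open>a\<close> and \<open>b\<close>.\<close>
  also have "(\<Sum>a<L. \<Sum>b<L. s a a + s b b - s a b - s b a)
      = 2 * of_nat L * (\<Sum>a<L. s a a) - 2 * (\<Sum>a<L. \<Sum>b<L. s a b)"
    using sum.swap[of "\<lambda>a b. s b a" "{..<L}" "{..<L}"]
    by (simp add: sum.distrib sum_subtractf flip: sum_distrib_left)
  finally show ?thesis
    by (simp add: total diag)
qed

text \<open>The comparison of quadratic forms becomes one of norms, because the norm of a positive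
  matrix is controlled by its quadratic form.\<close>

lemma op_norm_le_pinch:
  assumes pos: "positive_mat n X" and \<beta>: "\<And>i. i < n \<Longrightarrow> \<beta> i < L"
  shows "op_norm X \<le> real L * op_norm (pinch n \<beta> X)"
\<comment> \<open>The bound by quadratic forms asks for a strictly positive constant, while
  \<open>L\<close> times the norm of the pinching may be zero; hence the slack
  \<open>e\<close>.\<close>
proof (rule field_le_epsilon)
  fix e :: real assume e: "0 < e"
  let ?c = "real L * op_norm (pinch n \<beta> X)"
  have X: "X \<in> carrier_mat n n"
    using pos by (simp add: positive_mat_def)
  have c: "0 \<le> ?c"
    by (simp add: op_norm_nonneg)
  show "op_norm X \<le> ?c + e"
  proof (rule positive_mat_op_norm_le[OF pos])
    show "0 < ?c + e"
      using e c by linarith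
    fix v :: "complex vec" assume v: "v \<in> carrier_vec n"
    let ?E = "pinch n \<beta> X"
    have Ev: "?E *\<^sub>v v \<in> carrier_vec n"
      using pinch_carrier v by (rule mult_mat_vec_carrier)
    have "Re ((X *\<^sub>v v) \<bullet>c v) \<le> real L * Re ((?E *\<^sub>v v) \<bullet>c v)"
      using sesq_le_pinch[OF pos \<beta>, where f = "($) v"]
      by (simp add: sesq_eq_cscalar_prod[OF X v v] sesq_eq_cscalar_prod[OF pinch_carrier v v])
    also have "\<dots> \<le> real L * (vec_norm2 (?E *\<^sub>v v) * vec_norm2 v)"
      by (intro mult_left_mono order_trans[OF complex_Re_le_cmod cmod_cscalar_prod_le[OF Ev v]]) simp
    also have "\<dots> \<le> real L * (op_norm ?E * vec_norm2 v * vec_norm2 v)"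
      by (intro mult_left_mono mult_right_mono vec_norm2_mult_le[OF pinch_carrier v]
          vec_norm2_nonneg) simp
    also have "\<dots> = ?c * (vec_norm2 v)\<^sup>2"
      by (simp add: power2_eq_square)
    also have "\<dots> \<le> (?c + e) * (vec_norm2 v)\<^sup>2"
      using e by (intro mult_right_mono) auto
    finally show "Re ((X *\<^sub>v v) \<bullet>c v) \<le> (?c + e) * (vec_norm2 v)\<^sup>2" .
  qed
qed

section \<open>The conditional expectation is the pinching\<close>

text \<open>After squaring, \<open>t^2 * z^2\<close> cancels and
  \<open>(1 + 2 * t) * z^2 \<le> c\<close> remains, which fails for large \<open>t\<close> unless
  \<open>z\<close> vanishes.\<close>

lemma eq_zero_if_growth_bounded:
  fixes z c :: real
  assumes "0 \<le> z" and "\<And>t. 0 < t \<Longrightarrow> (1 + t) * z \<le> sqrt (c + (t * z)\<^sup>2)"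
  shows "z = 0"
proof (rule ccontr)
  assume "z \<noteq> 0"
  then have z: "0 < z"
    using assms(1) by simp
  have c: "(1 + 2 * t) * z\<^sup>2 \<le> c" if "0 < t" for t
  proof -
    have pos: "0 < (1 + t) * z"
      using that z by simp
    \<comment> \<open>The sign of \<open>c\<close> is not given, and squaring the root returns the
      radicand only if that is nonnegative.\<close>
    then have "0 < c + (t * z)\<^sup>2"
      using assms(2)[OF that] real_sqrt_gt_0_iff by (meson less_le_trans)
    then have "((1 + t) * z)\<^sup>2 \<le> c + (t * z)\<^sup>2"
      using assms(2)[OF that] pos by (metis less_imp_le power_mono real_sqrt_pow2)
    then show ?thesis
      by (simp add: algebra_simps power2_eq_square)
  qed
  have "0 < c"
    using order_less_le_trans[OF _ c[of 1], of 0] z by simp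
  \<comment> \<open>The choice \<open>t = c / z^2\<close> turns the bound into
    \<open>z^2 + 2 * c \<le> c\<close>.\<close>
  then have "(1 + 2 * (c / z\<^sup>2)) * z\<^sup>2 \<le> c"
    using z by (intro c) simp
  then show False
    using z add_pos_pos[OF \<open>0 < c\<close> zero_less_power[OF z, of 2]] by (simp add: algebra_simps)
qed

text \<open>A nonzero entry \<open>z\<close> of \<open>P X\<close> at \<open>(k, l)\<close> would be amplified to \<open>(1 + t) z\<close> by adding
  \<open>t z\<close> times the matrix unit at \<open>(k, l)\<close> to \<open>X\<close>. Since \<open>X\<close> vanishes there, the Frobenius norm
  grows too slowly for \<open>P\<close> to be contractive when \<open>t\<close> is large.\<close>

lemma conditional_expectation_off_block:
  assumes P: "conditional_expectation n (pinched_mats n \<beta>) P"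
    and X: "X \<in> carrier_mat n n"
    and off: "\<And>i j. i < n \<Longrightarrow> j < n \<Longrightarrow> \<beta> i = \<beta> j \<Longrightarrow> X $$ (i, j) = 0"
  shows "P X = 0\<^sub>m n n"
proof (rule eq_matI)
  have PX: "P X \<in> pinched_mats n \<beta>"
    using P X by (auto simp: conditional_expectation_def)
  then have PXc: "P X \<in> carrier_mat n n"
    by (simp add: pinched_mats_def)
  then show "dim_row (P X) = dim_row (0\<^sub>m n n)" "dim_col (P X) = dim_col (0\<^sub>m n n)"
    by auto
  have contractive: "op_norm (P Z) \<le> op_norm Z" if "Z \<in> carrier_mat n n" for Z
    using P that by (simp add: conditional_expectation_def)
  fix k l assume "k < dim_row (0\<^sub>m n n)" "l < dim_col (0\<^sub>m n n)"
  then have kl: "k < n" "l < n"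
    by auto
  show "P X $$ (k, l) = 0\<^sub>m n n $$ (k, l)"
  proof (cases "\<beta> k = \<beta> l")
    case False
    then show ?thesis
      using PX kl by (simp add: pinched_mats_def)
  next
    case True
    define z where "z = P X $$ (k, l)"
    define F where "F = (\<Sum>i<n. \<Sum>j<n. (cmod (X $$ (i, j)))\<^sup>2)"
    have "cmod z = 0"
    proof (rule eq_zero_if_growth_bounded)
      fix t :: real assume t: "0 < t"
      define Y where "Y = mat n n (\<lambda>(i, j). if i = k \<and> j = l then of_real t * z else 0)"
      have Y: "Y \<in> pinched_mats n \<beta>" "Y \<in> carrier_mat n n"
        using True by (auto simp: Y_def pinched_mats_def)
      \<comment> \<open>\<open>Y\<close> has its only possibly nonzero entry inside a block, so
        \<open>P\<close> fixes it.\<close>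
      have PXY: "P (X + Y) = P X + Y"
        using P X Y by (auto simp: conditional_expectation_def)
      have "(1 + t) * cmod z = cmod (of_real (1 + t) * z)"
        using t by (simp add: norm_mult flip: of_real_add)
      also have "of_real (1 + t) * z = (P X + Y) $$ (k, l)"
        using kl PXc by (simp add: Y_def z_def algebra_simps)
      also have "cmod \<dots> \<le> op_norm (P (X + Y))"
        unfolding PXY using PXc Y kl by (intro cmod_index_le_op_norm[of _ n n]) auto
      also have "\<dots> \<le> op_norm (X + Y)"
        using X Y by (intro contractive) simp
      also have "\<dots> \<le> sqrt (\<Sum>i<n. \<Sum>j<n. (cmod ((X + Y) $$ (i, j)))\<^sup>2)"
        using X Y by (intro op_norm_le_frobenius) auto
      \<comment> \<open>\<open>X\<close> vanishes at \<open>(k, l)\<close>, so the squared moduli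
        simply add, without a cross term.\<close>
      also have "(\<Sum>i<n. \<Sum>j<n. (cmod ((X + Y) $$ (i, j)))\<^sup>2)
          = (\<Sum>i<n. \<Sum>j<n. (cmod (X $$ (i, j)))\<^sup>2
              + (if l = j then (if k = i then (t * cmod z)\<^sup>2 else 0) else 0))"
        using X off True t
        by (intro sum.cong refl) (auto simp: Y_def norm_mult power_mult_distrib)
      also have "\<dots> = F + (t * cmod z)\<^sup>2"
        using kl by (simp add: sum.distrib F_def)
      finally show "(1 + t) * cmod z \<le> sqrt (F + (t * cmod z)\<^sup>2)" .
    qed simp
    then show ?thesis
      using kl by (simp add: z_def)
  qed
qed

text \<open>Split \<open>X\<close> into its pinching and the rest \<open>D\<close>: the former lies
  in the range and is fixed by \<open>P\<close>, while \<open>D\<close> vanishes on all blocks and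
  is sent to zero.\<close>

lemma conditional_expectation_eq_pinch:
  assumes P: "conditional_expectation n (pinched_mats n \<beta>) P" and X: "X \<in> carrier_mat n n"
  shows "P X = pinch n \<beta> X"
proof -
  let ?E = "pinch n \<beta> X"
  define D where "D = X - ?E"
  have D: "D \<in> carrier_mat n n"
    unfolding D_def by (rule minus_carrier_mat[OF pinch_carrier])
  have "P D = 0\<^sub>m n n"
    by (rule conditional_expectation_off_block[OF P D]) (use X in \<open>auto simp: D_def pinch_def\<close>)
  moreover have "P (?E + D) = P ?E + P D"
    using P D pinch_carrier by (simp add: conditional_expectation_def)
  moreover have "P ?E = ?E"
    using P pinch_mem by (simp add: conditional_expectation_def)
  moreover have "?E + D = X"
    using X by (auto simp: D_def pinch_def)
  ultimately show ?thesis
    using pinch_carrier[of n \<beta> X] by simp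
qed

lemma conditional_expectation_pinch:
  assumes "\<And>i. i < n \<Longrightarrow> \<beta> i < L"
  shows "conditional_expectation n (pinched_mats n \<beta>) (restrict (pinch n \<beta>) (carrier_mat n n))"
proof -
  have "B \<in> carrier_mat n n" if "B \<in> pinched_mats n \<beta>" for B
    using that by (simp add: pinched_mats_def)
  moreover have "pinch n \<beta> (X + Y) = pinch n \<beta> X + pinch n \<beta> Y"
    if "X \<in> carrier_mat n n" "Y \<in> carrier_mat n n" for X Y
    using that by (auto simp: pinch_def)
  moreover have "pinch n \<beta> (c \<cdot>\<^sub>m X) = c \<cdot>\<^sub>m pinch n \<beta> X" if "X \<in> carrier_mat n n" for c X
    using that by (auto simp: pinch_def)
  ultimately show ?thesis
    using assms
    by (auto simp: conditional_expectation_def pinch_mem pinch_eq_self intro!: op_norm_pinch_le)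
qed

text \<open>Existence and uniqueness together evaluate the description operator. The trace is
  preserved because pinching keeps the diagonal.\<close>

lemma cond_exp_eq_pinch:
  assumes \<beta>: "\<And>i. i < n \<Longrightarrow> \<beta> i < L" and X: "X \<in> carrier_mat n n"
  shows "cond_exp n (pinched_mats n \<beta>) X = pinch n \<beta> X"
proof -
  have "cond_exp n (pinched_mats n \<beta>) = restrict (pinch n \<beta>) (carrier_mat n n)"
    unfolding cond_exp_def
  proof (rule the_equality)
    show "restrict (pinch n \<beta>) (carrier_mat n n) \<in> extensional (carrier_mat n n) \<and>
        conditional_expectation n (pinched_mats n \<beta>) (restrict (pinch n \<beta>) (carrier_mat n n)) \<and>
        (\<forall>X\<in>carrier_mat n n. tau n (restrict (pinch n \<beta>) (carrier_mat n n) X) = tau n X)"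
      using conditional_expectation_pinch[OF \<beta>] by (simp add: tau_def pinch_def)
  next
    fix P
    assume "P \<in> extensional (carrier_mat n n) \<and>
        conditional_expectation n (pinched_mats n \<beta>) P \<and>
        (\<forall>X\<in>carrier_mat n n. tau n (P X) = tau n X)"
    then show "P = restrict (pinch n \<beta>) (carrier_mat n n)"
      using conditional_expectation_eq_pinch[of n \<beta> P]
      by (intro extensionalityI[of _ "carrier_mat n n"]) auto
  qed
  then show ?thesis
    using X by simp
qed

section \<open>Block-diagonal matrices\<close>

text \<open>Blocks are counted from 0; an index beyond the last block gets the value
  \<open>length ns\<close>.\<close>

fun block_index :: "nat list \<Rightarrow> nat \<Rightarrow> nat" where
  "block_index [] i = 0"
| "block_index (k # ns) i = (if i < k then 0 else Suc (block_index ns (i - k)))"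

lemma block_index_less: "i < sum_list ns \<Longrightarrow> block_index ns i < length ns"
  by (induction ns arbitrary: i) auto

lemma block_diag_algebra_Cons:
  "block_diag_algebra (k # ns) =
     {four_block_mat A (0\<^sub>m (dim_row A) (dim_col B)) (0\<^sub>m (dim_row B) (dim_col A)) B | A B.
        A \<in> carrier_mat k k \<and> B \<in> block_diag_algebra ns}" (is "?l = ?r")
proof
  show "?l \<subseteq> ?r"
  proof
    fix M assume "M \<in> ?l"
    then obtain A As where *: "A \<in> carrier_mat k k"
      "list_all2 (\<lambda>A k. A \<in> carrier_mat k k) As ns" "M = diag_block_mat (A # As)"
      by (auto simp: block_diag_algebra_def list_all2_Cons2)
    then have "diag_block_mat As \<in> block_diag_algebra ns"
      by (auto simp: block_diag_algebra_def)
    with * show "M \<in> ?r"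
      unfolding diag_block_mat.simps Let_def by blast
  qed
  show "?r \<subseteq> ?l"
  proof
    fix M assume "M \<in> ?r"
    then obtain A As where "A \<in> carrier_mat k k" "list_all2 (\<lambda>A k. A \<in> carrier_mat k k) As ns"
      "M = diag_block_mat (A # As)"
      by (auto simp: block_diag_algebra_def Let_def)
    then show "M \<in> ?l"
      unfolding block_diag_algebra_def by (intro CollectI exI[of _ "A # As"]) simp
  qed
qed

text \<open>Induction peels off the first block. Shifting indices by \<open>k\<close> raises the
  labels of the remaining blocks by one, so it preserves which labels are equal, and the label 0 is
  left to the first block.\<close>

lemma block_diag_algebra_eq_pinched_mats:
  "block_diag_algebra ns = pinched_mats (sum_list ns) (block_index ns)"
proof (induction ns)
  case Nil
  show ?case
    by (auto simp: block_diag_algebra_def pinched_mats_def intro!: eq_matI)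
next
  case (Cons k ns)
  let ?m = "sum_list ns"
  show ?case
  proof
    show "block_diag_algebra (k # ns) \<subseteq> pinched_mats (sum_list (k # ns)) (block_index (k # ns))"
      by (auto simp: block_diag_algebra_Cons Cons.IH pinched_mats_def)
    show "pinched_mats (sum_list (k # ns)) (block_index (k # ns)) \<subseteq> block_diag_algebra (k # ns)"
    proof
      fix M assume M: "M \<in> pinched_mats (sum_list (k # ns)) (block_index (k # ns))"
      define A where "A = mat k k (\<lambda>(i, j). M $$ (i, j))"
      define B where "B = mat ?m ?m (\<lambda>(i, j). M $$ (i + k, j + k))"
      have Mc: "M \<in> carrier_mat (k + ?m) (k + ?m)"
        and zero: "\<And>i j. i < k + ?m \<Longrightarrow> j < k + ?m \<Longrightarrow>
          block_index (k # ns) i \<noteq> block_index (k # ns) j \<Longrightarrow> M $$ (i, j) = 0"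
        using M unfolding pinched_mats_def by auto
      have "B \<in> block_diag_algebra ns"
        by (simp add: Cons.IH pinched_mats_def B_def zero)
      moreover have "A \<in> carrier_mat k k"
        by (simp add: A_def)
      moreover have "M = four_block_mat A (0\<^sub>m (dim_row A) (dim_col B))
          (0\<^sub>m (dim_row B) (dim_col A)) B"
        using Mc by (intro eq_matI) (simp_all add: A_def B_def zero)
      ultimately show "M \<in> block_diag_algebra (k # ns)"
        unfolding block_diag_algebra_Cons by blast
    qed
  qed
qed

theorem theorem4p5:
  fixes n L :: nat and ns :: "nat list"
  assumes "n \<ge> 1" and "L \<ge> 1" and "length ns = L"
    and "\<forall>k \<in> set ns. k \<ge> 1"
    and "n = sum_list ns"
  shows "(\<forall>X \<in> carrier_mat n n. positive_mat n X \<longrightarrow>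
            1 / real L * op_norm X \<le> op_norm (cond_exp n (block_diag_algebra ns) X)) \<and>
         (\<forall>X \<in> carrier_mat n n.
            1 / sqrt (real L) * op_norm X \<le> frobenius_rieffel_norm n (block_diag_algebra ns) X)"
proof -
  have index: "block_index ns i < L" if "i < n" for i
    using that assms block_index_less by blast
  have main: "1 / real L * op_norm X \<le> op_norm (cond_exp n (block_diag_algebra ns) X)"
    if X: "X \<in> carrier_mat n n" and pos: "positive_mat n X" for X
    \<comment> \<open>Here the labelling is \<open>block_index ns\<close>, with values below
      \<open>L\<close>, and \<open>L \<ge> 1\<close> permits dividing by it.\<close>
    using op_norm_le_pinch[OF pos, of "block_index ns" L] cond_exp_eq_pinch[OF index X] index assms
    by (simp add: block_diag_algebra_eq_pinched_mats field_simps)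
  moreover have "1 / sqrt (real L) * op_norm X \<le> frobenius_rieffel_norm n (block_diag_algebra ns) X"
    if X: "X \<in> carrier_mat n n" for X
  proof -
    have "1 / real L * (op_norm X)\<^sup>2 \<le> 1 / real L * op_norm (mat_adjoint X * X)"
      using op_norm_power2_le[OF X] by (intro mult_left_mono) auto
    also have "\<dots> \<le> op_norm (cond_exp n (block_diag_algebra ns) (mat_adjoint X * X))"
      using X by (intro main mat_adjoint_mult_carrier positive_mat_adjoint_mult)
    finally have "sqrt (1 / real L * (op_norm X)\<^sup>2)
        \<le> sqrt (op_norm (cond_exp n (block_diag_algebra ns) (mat_adjoint X * X)))"
      by (rule real_sqrt_le_mono)
    then show ?thesis
      by (simp add: frobenius_rieffel_norm_def real_sqrt_mult real_sqrt_divide op_norm_nonneg)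
  qed
  ultimately show ?thesis
    by blast
qed

end
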